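(* Define the interior operator on names by: for all $P,Q:N$, $\eta\,P\,(\mathit{interior}\,Q) \iff (\eta\,Q\,Q \wedge \eta\,P\,Q)$. Then the following four properties hold (Kuratowski's axioms in interior form, with open sets being the individuals): (1) $\mathit{interior}\,\mathit{Universe} \equiv \mathit{Universe}$; (2) for every $Q$ with $\eta\,Q\,Q$: $\mathit{interior}\,Q \equiv Q$; (3) for every $Q$ with $\eta\,Q\,Q$: $\mathit{interior}\,(\mathit{interior}\,Q) \equiv \mathit{interior}\,Q$; (4) for all $A,B$ with $\eta\,A\,A$ and $\eta\,B\,B$, and for all $P,Q,R$: if $P \equiv \mathit{interior}\,A$, $Q\equiv \mathit{interior}\,B$ and $R \equiv \mathit{b\_product}\,A\,B$, then $\mathit{b\_product}\,P\,Q \equiv \mathit{interior}\,R$.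
   Context: Setting: a Coq formalization (classical logic) of Leśniewski's Ontology and Mereology. There is a type $N$ of names and a primitive relation $\eta : N\to N\to\mathrm{Prop}$ satisfying Leśniewski's ontological axiom: $\eta\,A\,b \leftrightarrow \big((\exists C,\ \eta\,C\,A)\wedge(\forall C\,D,\ \eta\,C\,A\wedge\eta\,D\,A\to\eta\,C\,D)\wedge(\forall C,\ \eta\,C\,A\to\eta\,C\,b)\big)$. A name $A$ is an individual iff $\eta\,A\,A$. For names $a,b$: $a\cup b$ and $a\cap b$ are the names with $\eta\,P\,(a\cup b)\leftrightarrow(\eta\,P\,a\vee\eta\,P\,b)$ and $\eta\,P\,(a\cap b)\leftrightarrow(\eta\,P\,a\wedge\eta\,P\,b)$; $a\approx b$ means $\forall P,\ \eta\,P\,a\leftrightarrow\eta\,P\,b$; $P\equiv Q$ (singular equality) means $\eta\,P\,Q\wedge\eta\,Q\,P$; $V$ is the universal name ($\eta\,P\,V\leftrightarrow\eta\,P\,P$). Mereology: a function $pt:N\to N$ ($\eta\,B\,(pt\,A)$ reads "$B$ is a part of $A$") satisfying Leśniewski's mereology axioms (part-of is a reflexive, antisymmetric, transitive relation between individuals, and every non-empty name has a unique m-class). The m-class: $\eta\,A\,(klass\,a)$ iff $\eta\,A\,A$, and $\forall B,\ \eta\,B\,a\to\eta\,B\,(pt\,A)$, and $\forall B,\ \eta\,B\,(pt\,A)\to\exists C\,D,\ \eta\,C\,a\wedge\eta\,D\,(pt\,C)\wedge\eta\,D\,(pt\,B)$. $\eta\,P\,\mathit{Universe}$ iff $\eta\,P\,(klass\,V)$.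 Meet: $\eta\,R\,(\mathit{b\_product}\,P\,Q)$ iff $\eta\,P\,P\wedge\eta\,Q\,Q\wedge\eta\,R\,(klass\,((pt\,P)\cap(pt\,Q)))$.
   Formalization: The formal theorem additionally assumes that at least one individual exists; without it the listed axioms allow the empty relation η, for which (1) fails, while (2)–(4) hold vacuously. *)

theory Defs
  imports Main
begin

definition sing_eq :: "('n \<Rightarrow> 'n \<Rightarrow> bool) \<Rightarrow> 'n \<Rightarrow> 'n \<Rightarrow> bool" where
  "sing_eq \<eta> P Q \<longleftrightarrow> \<eta> P Q \<and> \<eta> Q P"

text \<open>
  Names are only characterised by what is \<open>\<eta>\<close>-below them: distinct elements of \<open>'n\<close> may be
  coextensional, so the term-forming operators are functions constrained by their defining
  equivalences, not determined up to HOL equality.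
\<close>

locale ontology =
  fixes \<eta> :: "'n \<Rightarrow> 'n \<Rightarrow> bool"
    and union :: "'n \<Rightarrow> 'n \<Rightarrow> 'n"
    and inter :: "'n \<Rightarrow> 'n \<Rightarrow> 'n"
    and V :: 'n
  assumes ontological_axiom:
      "\<eta> A b \<longleftrightarrow>
        (\<exists>C. \<eta> C A) \<and> (\<forall>C D. \<eta> C A \<and> \<eta> D A \<longrightarrow> \<eta> C D) \<and> (\<forall>C. \<eta> C A \<longrightarrow> \<eta> C b)"
    and eta_union: "\<eta> P (union a b) \<longleftrightarrow> \<eta> P a \<or> \<eta> P b"
    and eta_inter: "\<eta> P (inter a b) \<longleftrightarrow> \<eta> P a \<and> \<eta> P b"
    and eta_V: "\<eta> P V \<longleftrightarrow> \<eta> P P"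

locale mereology = ontology \<eta> union inter V
  for \<eta> :: "'n \<Rightarrow> 'n \<Rightarrow> bool"
    and union :: "'n \<Rightarrow> 'n \<Rightarrow> 'n"
    and inter :: "'n \<Rightarrow> 'n \<Rightarrow> 'n"
    and V :: 'n +
  fixes pt :: "'n \<Rightarrow> 'n"
    and klass :: "'n \<Rightarrow> 'n"
    and Universe :: 'n
    and b_product :: "'n \<Rightarrow> 'n \<Rightarrow> 'n"
  assumes pt_individuals: "\<eta> B (pt A) \<Longrightarrow> \<eta> B B \<and> \<eta> A A"
    and pt_refl: "\<eta> A A \<Longrightarrow> \<eta> A (pt A)"
    and pt_antisym: "\<eta> A (pt B) \<Longrightarrow> \<eta> B (pt A) \<Longrightarrow> sing_eq \<eta> A B"
    and pt_trans: "\<eta> A (pt B) \<Longrightarrow> \<eta> B (pt C) \<Longrightarrow> \<eta> A (pt C)"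
    and eta_klass:
      "\<eta> A (klass a) \<longleftrightarrow>
        \<eta> A A \<and> (\<forall>B. \<eta> B a \<longrightarrow> \<eta> B (pt A)) \<and>
        (\<forall>B. \<eta> B (pt A) \<longrightarrow> (\<exists>C D. \<eta> C a \<and> \<eta> D (pt C) \<and> \<eta> D (pt B)))"
    and klass_exists: "\<eta> B a \<Longrightarrow> \<exists>A. \<eta> A (klass a)"
    and klass_unique: "\<eta> A (klass a) \<Longrightarrow> \<eta> B (klass a) \<Longrightarrow> sing_eq \<eta> A B"
    and eta_Universe: "\<eta> P Universe \<longleftrightarrow> \<eta> P (klass V)"
    and eta_b_product:
      "\<eta> R (b_product P Q) \<longleftrightarrow> \<eta> P P \<and> \<eta> Q Q \<and> \<eta> R (klass (inter (pt P) (pt Q)))"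

text \<open>
  The axioms admit the empty \<open>\<eta>\<close>, for which no singular equality holds at all.  Any claim that
  \<open>Universe\<close> is singularly equal to something therefore needs an individual to exist.
\<close>

lemma mereology_empty_model:
  fixes op2 :: "'n \<Rightarrow> 'n \<Rightarrow> 'n" and op1 :: "'n \<Rightarrow> 'n" and c :: 'n
  shows "mereology (\<lambda>_ _. False) op2 op2 c op1 op1 c op2"
    and "\<not> sing_eq (\<lambda>_ _. False) P Q"
  by (unfold_locales) (auto simp: sing_eq_def)

end

theory Submission imports Defs begin

text \<open>
  By the ontological axiom, \<open>\<eta> A b\<close> depends on \<open>A\<close> only through its extension, so singular
  equality is the same as being coextensional with an individual.  The interior of an individual
  is coextensional with it, and the universe is an individual as soon as one exists, because
  m-classes of non-empty names are unique.  Singularly equal individuals have the same parts,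
  hence the meets built from them are coextensional.
\<close>

context ontology
begin

lemma eta_self: "\<eta> A b \<Longrightarrow> \<eta> A A"
  using ontological_axiom[of A b] ontological_axiom[of A A] by blast

lemma eta_trans: "\<eta> C A \<Longrightarrow> \<eta> A b \<Longrightarrow> \<eta> C b"
  using ontological_axiom[of A b] by blast

lemma sing_eq_iff_coextensional:
  "sing_eq \<eta> P Q \<longleftrightarrow> \<eta> Q Q \<and> (\<forall>C. \<eta> C P \<longleftrightarrow> \<eta> C Q)"
proof
  assume "sing_eq \<eta> P Q"
  then show "\<eta> Q Q \<and> (\<forall>C. \<eta> C P \<longleftrightarrow> \<eta> C Q)"
    unfolding sing_eq_def using eta_self eta_trans by metis
next
  assume Q: "\<eta> Q Q \<and> (\<forall>C. \<eta> C P \<longleftrightarrow> \<eta> C Q)"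
  \<comment> \<open>In the axiom for \<eta> P Q, the right-hand side sees \<open>P\<close> only
    through the names below it, so it agrees with the one for \<eta> Q Q.\<close>
  then have "\<eta> P Q"
    using ontological_axiom[of P Q] ontological_axiom[of Q Q] by metis
  with Q show "sing_eq \<eta> P Q"
    by (simp add: sing_eq_def)
qed

lemma sing_eq_sym: "sing_eq \<eta> P Q \<Longrightarrow> sing_eq \<eta> Q P"
  by (simp add: sing_eq_def)

lemma sing_eq_trans: "sing_eq \<eta> P Q \<Longrightarrow> sing_eq \<eta> Q R \<Longrightarrow> sing_eq \<eta> P R"
  by (simp add: sing_eq_iff_coextensional)

end

context mereology
begin

text \<open>Each of \<open>P\<close> and \<open>Q\<close> is a part of the other, by reflexivity of
  parthood carried along \<eta>; transitivity does the rest.\<close>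

lemma eta_pt_cong:
  assumes "sing_eq \<eta> P Q"
  shows "\<eta> C (pt P) \<longleftrightarrow> \<eta> C (pt Q)"
proof -
  have "\<eta> P (pt Q)" "\<eta> Q (pt P)"
    using assms unfolding sing_eq_def using eta_self eta_trans pt_refl by metis+
  then show ?thesis
    by (blast intro: pt_trans)
qed

text \<open>\<open>pt P\<close> and \<open>pt P'\<close> may be distinct elements of the type, so
  nothing can be rewritten under \<open>klass\<close>. Unfolding \<open>eta_klass\<close> leaves its
  argument only to the right of \<eta>, where coextensionality suffices.\<close>

lemma eta_b_product_cong:
  assumes "sing_eq \<eta> P P'" and "sing_eq \<eta> Q Q'"
  shows "\<eta> R (b_product P Q) \<longleftrightarrow> \<eta> R (b_product P' Q')"
proof -
  have "\<eta> P P" "\<eta> P' P'" "\<eta> Q Q" "\<eta> Q' Q'"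
    using assms unfolding sing_eq_def using eta_self by metis+
  then show ?thesis
    by (simp add: eta_b_product eta_klass eta_inter eta_pt_cong[OF assms(1)] eta_pt_cong[OF assms(2)])
qed

lemma Universe_individual:
  assumes "\<eta> A A"
  shows "\<eta> Universe Universe"
proof -
  have "\<exists>U. \<eta> U Universe"
    using assms klass_exists[of A V] by (simp add: eta_V eta_Universe)
  \<comment> \<open>Uniqueness of m-classes is the middle clause of the ontological axiom; the last
    clause is trivial when \<open>b\<close> is \<open>Universe\<close> itself.\<close>
  moreover have "\<eta> C D" if "\<eta> C Universe" "\<eta> D Universe" for C D
    using that klass_unique[of C V D] by (simp add: eta_Universe sing_eq_def)
  ultimately show ?thesis
    using ontological_axiom[of Universe Universe] by blast
qed

end

theorem theorem1:
  fixes \<eta> :: "'n \<Rightarrow> 'n \<Rightarrow> bool"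
    and union inter b_product :: "'n \<Rightarrow> 'n \<Rightarrow> 'n"
    and pt klass interior :: "'n \<Rightarrow> 'n"
    and V Universe :: 'n
  assumes mereology: "mereology \<eta> union inter V pt klass Universe b_product"
    and individual_exists: "\<exists>A. \<eta> A A"
    and eta_interior: "\<And>P Q. \<eta> P (interior Q) \<longleftrightarrow> \<eta> Q Q \<and> \<eta> P Q"
  shows "sing_eq \<eta> (interior Universe) Universe
    \<and> (\<forall>Q. \<eta> Q Q \<longrightarrow> sing_eq \<eta> (interior Q) Q)
    \<and> (\<forall>Q. \<eta> Q Q \<longrightarrow> sing_eq \<eta> (interior (interior Q)) (interior Q))
    \<and> (\<forall>A B. \<eta> A A \<and> \<eta> B B \<longrightarrow>
        (\<forall>P Q R. sing_eq \<eta> P (interior A) \<and> sing_eq \<eta> Q (interior B)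
            \<and> sing_eq \<eta> R (b_product A B) \<longrightarrow>
          sing_eq \<eta> (b_product P Q) (interior R)))"
proof -
  interpret mereology \<eta> union inter V pt klass Universe b_product
    by (fact mereology)
  have interior: "sing_eq \<eta> (interior Q) Q" if "\<eta> Q Q" for Q
    using that by (simp add: sing_eq_iff_coextensional eta_interior)
  \<comment> \<open>This lets \<open>interior\<close> be applied to \<open>interior Q\<close>, which
    is the idempotence claim.\<close>
  have interior_individual: "\<eta> (interior Q) (interior Q)" if "\<eta> Q Q" for Q
    using interior[OF that] eta_self unfolding sing_eq_def by blast
  have "\<eta> Universe Universe"
    using individual_exists Universe_individual by blast
  moreover have "sing_eq \<eta> (b_product P Q) (interior R)"
    if "\<eta> A A" "\<eta> B B" "sing_eq \<eta> P (interior A)" "sing_eq \<eta> Q (interior B)"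
      and R: "sing_eq \<eta> R (b_product A B)"
    for A B P Q R
  proof -
    have "sing_eq \<eta> P A" "sing_eq \<eta> Q B"
      using that interior sing_eq_trans by blast+
    then have "\<eta> C (b_product P Q) \<longleftrightarrow> \<eta> C (b_product A B)" for C
      by (rule eta_b_product_cong)
    \<comment> \<open>Disjoint \<open>A\<close> and \<open>B\<close> have an empty meet; it is
      \<open>R\<close> that forces \<open>b_product A B\<close> to be an individual.\<close>
    with R have "sing_eq \<eta> (b_product P Q) R"
      using sing_eq_sym[OF R] by (simp add: sing_eq_iff_coextensional)
    moreover have "\<eta> R R"
      using R eta_self unfolding sing_eq_def by blast
    ultimately show ?thesis
      using interior sing_eq_sym sing_eq_trans by blast
  qed
  ultimately show ?thesis
    by (intro conjI allI impI; (elim conjE)?) (assumption | rule interior interior_individual)+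
qed

end
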